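(* Let $N\ge 1$, let $\mathcal{A}$ be a finite set, and let $\mathbf{X}=(X_1,\dots,X_N)$ be a time-homogeneous Markov chain on $\mathcal{A}$ with an arbitrary initial distribution and one-step transition kernel $P(\cdot\mid\cdot)$. Suppose its Dobrushin contraction coefficient $$\alpha := \max_{x,x'\in\mathcal{A}} d_{\mathrm{TV}}\bigl(P(\cdot\mid x),P(\cdot\mid x')\bigr)$$ satisfies $\alpha\in(0,1)$. Let $f:\mathcal{A}^N\to\mathbb{R}$ and $\mathbf{c}=(c_1,\dots,c_N)^\top\in\mathbb{R}^N$ be such that $|f(x)-f(y)|\le\sum_{j=1}^N c_j\mathbf{1}_{\{x_j\neq y_j\}}$ for all $x,y\in\mathcal{A}^N$. Then for every $t>0$, $$\mathbb{P}\bigl(|f(\mathbf{X})-\mathbb{E}[f(\mathbf{X})]|\ge t\bigr)\le 2\exp\left(-\frac{2t^2(1-\alpha)^2}{\|\mathbf{c}\|_2^2}\right).$$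
   Context: The law of $\mathbf{X}$ on $\mathcal{A}^N$ is $\mathbb{P}(X_{1:N}=x_{1:N}) = p_1(x_1)\prod_{j=2}^N P(x_j\mid x_{j-1})$, where $p_1$ is a probability measure on $\mathcal{A}$ and $P(\cdot\mid x)$ is a probability measure on $\mathcal{A}$ for every $x\in\mathcal{A}$. Total variation distance: $d_{\mathrm{TV}}(\mu,\nu)=\frac12\sum_{a\in\mathcal{A}}|\mu(a)-\nu(a)|$. $\|\mathbf{c}\|_2^2=\sum_{j=1}^N c_j^2$. Convention: if $\mathbf{c}=0$, the right-hand side is read as $0$. *)

theory Defs
  imports "HOL-Probability.Probability"
begin

definition tv_dist :: "'a set \<Rightarrow> 'a pmf \<Rightarrow> 'a pmf \<Rightarrow> real" where
  "tv_dist A \<mu> \<nu> = (1 / 2) * (\<Sum>a\<in>A. \<bar>pmf \<mu> a - pmf \<nu> a\<bar>)"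

definition dobrushin_coeff :: "'a set \<Rightarrow> ('a \<Rightarrow> 'a pmf) \<Rightarrow> real" where
  "dobrushin_coeff A P = Max {tv_dist A (P x) (P x') | x x'. x \<in> A \<and> x' \<in> A}"

text \<open>
  The space $A^N$ is rendered as \<open>{1..N} \<rightarrow>\<^sub>E A\<close>, so coordinates are numbered from 1.
  A probability measure on \<open>A\<close> is a \<open>pmf\<close> whose support lies in \<open>A\<close>;
  \<open>P x\<close> is the transition law $P(\cdot\mid x)$, constrained only for \<open>x \<in> A\<close>.
  The process may live on any probability space \<open>M\<close>.
\<close>

definition homogeneous_markov_chain ::
  "'w measure \<Rightarrow> 'a set \<Rightarrow> nat \<Rightarrow> 'a pmf \<Rightarrow> ('a \<Rightarrow> 'a pmf) \<Rightarrow> (nat \<Rightarrow> 'w \<Rightarrow> 'a) \<Rightarrow> bool" where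
  "homogeneous_markov_chain M A N p1 P X \<longleftrightarrow>
     prob_space M \<and>
     set_pmf p1 \<subseteq> A \<and>
     (\<forall>x\<in>A. set_pmf (P x) \<subseteq> A) \<and>
     (\<forall>j\<in>{1..N}. X j \<in> measurable M (count_space A)) \<and>
     (\<forall>x\<in>{1..N} \<rightarrow>\<^sub>E A.
        measure M {\<omega>\<in>space M. \<forall>j\<in>{1..N}. X j \<omega> = x j} =
          pmf p1 (x 1) * (\<Prod>j=2..N. pmf (P (x (j - 1))) (x j)))"

text \<open>The random element $(X_1,\dots,X_N)$ of $A^N$.\<close>

definition chain_path :: "nat \<Rightarrow> (nat \<Rightarrow> 'w \<Rightarrow> 'a) \<Rightarrow> 'w \<Rightarrow> nat \<Rightarrow> 'a" where
  "chain_path N X \<omega> = (\<lambda>j\<in>{1..N}. X j \<omega>)"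

end

theory Submission
  imports Defs
begin

text \<open>
  Integrating out the last coordinate of a function of \<open>k + 1\<close> steps of the chain gives a function
  of \<open>k\<close> steps.  By the dual description of total variation it again has bounded differences, the
  last constant becoming \<open>c k + \<alpha> * c (k + 1)\<close>, while Hoeffding's lemma bounds the loss in the
  moment generating function by the factor \<open>exp (s\<^sup>2 * (c (k + 1))\<^sup>2 / 8)\<close>.  Convexity, in the form
  \<open>(u + \<alpha> * v)\<^sup>2 \<le> u\<^sup>2 / (1 - \<alpha>) + \<alpha> * v\<^sup>2\<close>, makes the accumulated variance proxy at most
  \<open>(\<Sum>j. (c j)\<^sup>2) / (1 - \<alpha>)\<^sup>2\<close>, and Chernoff's method finishes the proof.
\<close>

section \<open>Total variation and Hoeffding's lemma on a finite set\<close>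

lemma bounded_diff_imp_interval:
  fixes h :: "'a \<Rightarrow> real"
  assumes "finite A" "A \<noteq> {}" and "\<And>a b. a \<in> A \<Longrightarrow> b \<in> A \<Longrightarrow> \<bar>h a - h b\<bar> \<le> D"
  obtains l where "\<And>a. a \<in> A \<Longrightarrow> h a \<in> {l..l + D}"
proof -
  have "Min (h ` A) \<in> h ` A"
    using assms by (intro Min_in) auto
  then obtain b where b: "b \<in> A" "h b = Min (h ` A)"
    by auto
  have "h a \<in> {h b..h b + D}" if "a \<in> A" for a
    using that b assms(3)[of a b] Min_le[of "h ` A" "h a"] \<open>finite A\<close> by auto
  then show thesis
    using that by blast
qed

text \<open>Both laws have mass 1, so subtracting a constant from \<open>h\<close> changes nothing.
  Centring at the midpoint \<open>m\<close> of an interval of length \<open>D\<close> leaves values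
  of size at most \<open>D / 2\<close>, and this half is the one in the definition of
  \<open>tv_dist\<close>.\<close>

lemma sum_pmf_diff_le_tv_dist:
  fixes h :: "'a \<Rightarrow> real"
  assumes "finite A" "set_pmf \<mu> \<subseteq> A" "set_pmf \<nu> \<subseteq> A"
    and "\<And>a b. a \<in> A \<Longrightarrow> b \<in> A \<Longrightarrow> \<bar>h a - h b\<bar> \<le> D"
  shows "\<bar>(\<Sum>a\<in>A. pmf \<mu> a * h a) - (\<Sum>a\<in>A. pmf \<nu> a * h a)\<bar> \<le> tv_dist A \<mu> \<nu> * D"
proof -
  have "A \<noteq> {}"
    using assms(2) set_pmf_not_empty[of \<mu>] by auto
  obtain l where l: "\<And>a. a \<in> A \<Longrightarrow> h a \<in> {l..l + D}"
    by (rule bounded_diff_imp_interval[OF assms(1) \<open>A \<noteq> {}\<close>, of h D]) (use assms(4) in blast)+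
  define m where "m = l + D / 2"
  have m: "\<bar>h a - m\<bar> \<le> D / 2" if "a \<in> A" for a
    using l[OF that] by (auto simp: m_def abs_le_iff field_simps)
  have one: "(\<Sum>a\<in>A. pmf \<mu> a) = 1" "(\<Sum>a\<in>A. pmf \<nu> a) = 1"
    using assms by (auto intro: sum_pmf_eq_1)
  have "(\<Sum>a\<in>A. pmf \<mu> a * h a) - (\<Sum>a\<in>A. pmf \<nu> a * h a)
      = (\<Sum>a\<in>A. (pmf \<mu> a - pmf \<nu> a) * (h a - m)) + m * ((\<Sum>a\<in>A. pmf \<mu> a) - (\<Sum>a\<in>A. pmf \<nu> a))"
    by (simp add: algebra_simps sum.distrib sum_subtractf sum_distrib_left)
  also have "\<dots> = (\<Sum>a\<in>A. (pmf \<mu> a - pmf \<nu> a) * (h a - m))"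
    by (simp add: one)
  also have "\<bar>\<dots>\<bar> \<le> (\<Sum>a\<in>A. \<bar>pmf \<mu> a - pmf \<nu> a\<bar> * (D / 2))"
    by (intro order.trans[OF sum_abs] sum_mono) (unfold abs_mult, intro mult_left_mono m abs_ge_zero)
  also have "\<dots> = tv_dist A \<mu> \<nu> * D"
    by (simp add: tv_dist_def sum_distrib_right)
  finally show ?thesis .
qed

text \<open>Hoeffding's lemma for a variable confined to an interval of length \<open>D\<close>, in
  the form needed for one step of the chain: with finite sums, and with the factor
  \<open>exp (s * E)\<close> of the centred version moved to the right.\<close>

lemma Hoeffding_pmf_finite:
  fixes h :: "'a \<Rightarrow> real"
  assumes "finite A" "set_pmf \<mu> \<subseteq> A" "s > 0"
    and "\<And>a b. a \<in> A \<Longrightarrow> b \<in> A \<Longrightarrow> \<bar>h a - h b\<bar> \<le> D"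
  shows "(\<Sum>a\<in>A. pmf \<mu> a * exp (s * h a)) \<le> exp (s * (\<Sum>a\<in>A. pmf \<mu> a * h a) + s\<^sup>2 * D\<^sup>2 / 8)"
proof -
  have "A \<noteq> {}"
    using assms(2) set_pmf_not_empty[of \<mu>] by auto
  obtain l where l: "\<And>a. a \<in> A \<Longrightarrow> h a \<in> {l..l + D}"
    by (rule bounded_diff_imp_interval[OF assms(1) \<open>A \<noteq> {}\<close>, of h D]) (use assms(4) in blast)+
  define E where "E = (\<Sum>a\<in>A. pmf \<mu> a * h a)"
  have fin: "finite (set_pmf \<mu>)"
    using assms finite_subset by blast
  have E: "measure_pmf.expectation \<mu> h = E"
    unfolding E_def using assms by (subst integral_measure_pmf_real[of A]) (auto simp: mult.commute)
  interpret interval_bounded_random_variable "measure_pmf \<mu>" h l "l + D"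
    by unfold_locales (use l assms in \<open>auto simp: AE_measure_pmf_iff\<close>)
  \<comment> \<open>The library bound concerns a nonnegative integral in \<open>ennreal\<close>;
    finite support supplies the integrability that brings it back to the reals.\<close>
  have "ennreal (measure_pmf.expectation \<mu> (\<lambda>a. exp (s * (h a - E))))
      = (\<integral>\<^sup>+ a. ennreal (exp (s * (h a - E))) \<partial>measure_pmf \<mu>)"
    using fin by (intro nn_integral_eq_integral[symmetric] integrable_measure_pmf_finite) auto
  also have "\<dots> \<le> ennreal (exp (s\<^sup>2 * D\<^sup>2 / 8))"
    using Hoeffdings_lemma_nn_integral[OF \<open>s > 0\<close>] by (simp add: E)
  finally have "measure_pmf.expectation \<mu> (\<lambda>a. exp (s * (h a - E))) \<le> exp (s\<^sup>2 * D\<^sup>2 / 8)"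
    by simp
  also have "measure_pmf.expectation \<mu> (\<lambda>a. exp (s * (h a - E)))
      = (\<Sum>a\<in>A. exp (s * (h a - E)) * pmf \<mu> a)"
    using assms by (intro integral_measure_pmf_real) auto
  also have "\<dots> = (\<Sum>a\<in>A. pmf \<mu> a * exp (s * h a)) / exp (s * E)"
    by (simp add: sum_divide_distrib exp_diff right_diff_distrib mult.commute)
  finally show ?thesis
    by (simp add: E_def exp_add divide_le_eq mult.commute)
qed

section \<open>Path weights and summing out the last coordinate\<close>

lemma sum_PiE_insert:
  assumes "i \<notin> I"
  shows "(\<Sum>x\<in>insert i I \<rightarrow>\<^sub>E A. g x) = (\<Sum>x\<in>I \<rightarrow>\<^sub>E A. \<Sum>a\<in>A. g (x(i := a)))"
proof -
  have "(\<Sum>x\<in>insert i I \<rightarrow>\<^sub>E A. g x) = (\<Sum>(a, x)\<in>A \<times> (I \<rightarrow>\<^sub>E A). g (x(i := a)))"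
    unfolding PiE_insert_eq using assms
    by (subst sum.reindex[OF inj_combinator]) (auto simp: case_prod_unfold)
  also have "\<dots> = (\<Sum>a\<in>A. \<Sum>x\<in>I \<rightarrow>\<^sub>E A. g (x(i := a)))"
    by (rule sum.cartesian_product[symmetric])
  also have "\<dots> = (\<Sum>x\<in>I \<rightarrow>\<^sub>E A. \<Sum>a\<in>A. g (x(i := a)))"
    by (rule sum.swap)
  finally show ?thesis .
qed

text \<open>The length \<open>k\<close> is a parameter so that the same formula gives the law of
  every initial segment of the chain; the induction runs on these.\<close>

definition path_weight :: "'a pmf \<Rightarrow> ('a \<Rightarrow> 'a pmf) \<Rightarrow> nat \<Rightarrow> (nat \<Rightarrow> 'a) \<Rightarrow> real" where
  "path_weight p1 P k x = pmf p1 (x 1) * (\<Prod>j=2..k. pmf (P (x (j - 1))) (x j))"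

lemma path_weight_nonneg: "path_weight p1 P k x \<ge> 0"
  by (auto simp: path_weight_def intro!: mult_nonneg_nonneg prod_nonneg)

lemma path_weight_Suc_upd:
  assumes "k \<ge> 1"
  shows "path_weight p1 P (Suc k) (x(Suc k := a)) = path_weight p1 P k x * pmf (P (x k)) a"
proof -
  have "(\<Prod>j=2..k. pmf (P ((x(Suc k := a)) (j - 1))) ((x(Suc k := a)) j))
      = (\<Prod>j=2..k. pmf (P (x (j - 1))) (x j))"
    by (intro prod.cong) auto
  then show ?thesis
    using assms by (simp add: path_weight_def)
qed

text \<open>Over the empty index set the extensional function space contains only the function that
  is \<open>undefined\<close> everywhere, so paths with one coordinate are its updates at 1.\<close>

lemma sum_path_weight_1:
  "(\<Sum>x\<in>{1..1} \<rightarrow>\<^sub>E A. path_weight p1 P 1 x * g x) = (\<Sum>a\<in>A. pmf p1 a * g ((\<lambda>_. undefined)(1 := a)))"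
  using sum_PiE_insert[of "1::nat" "{}" "\<lambda>x. path_weight p1 P 1 x * g x" A]
  by (simp add: path_weight_def fun_upd_def)

text \<open>Tower property: the inner sum is the conditional expectation given the first
  \<open>k\<close> coordinates. By the Markov property its weights depend on the path only through
  \<open>x k\<close>.\<close>

lemma sum_path_weight_Suc:
  assumes "k \<ge> 1"
  shows "(\<Sum>x\<in>{1..Suc k} \<rightarrow>\<^sub>E A. path_weight p1 P (Suc k) x * g x)
       = (\<Sum>x\<in>{1..k} \<rightarrow>\<^sub>E A. path_weight p1 P k x * (\<Sum>a\<in>A. pmf (P (x k)) a * g (x(Suc k := a))))"
proof -
  have "{1..Suc k} = insert (Suc k) {1..k}"
    by auto
  then show ?thesis
    using sum_PiE_insert[of "Suc k" "{1..k}" "\<lambda>x. path_weight p1 P (Suc k) x * g x" A] assms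
    by (simp add: path_weight_Suc_upd sum_distrib_left mult.assoc)
qed

lemma PiE_Suc_upd:
  "x \<in> {1..k} \<rightarrow>\<^sub>E A \<Longrightarrow> a \<in> A \<Longrightarrow> x(Suc k := a) \<in> {1..Suc k} \<rightarrow>\<^sub>E A"
  by (auto simp: PiE_iff extensional_def)

section \<open>Bounded differences after averaging over the last coordinate\<close>

lemma bounded_diff_last:
  fixes f :: "(nat \<Rightarrow> 'a) \<Rightarrow> real"
  assumes f: "\<And>x y. x \<in> {1..Suc k} \<rightarrow>\<^sub>E A \<Longrightarrow> y \<in> {1..Suc k} \<rightarrow>\<^sub>E A \<Longrightarrow>
              \<bar>f x - f y\<bar> \<le> (\<Sum>j=1..Suc k. c j * of_bool (x j \<noteq> y j))"
    and "c (Suc k) \<ge> 0" "x \<in> {1..k} \<rightarrow>\<^sub>E A" "a \<in> A" "b \<in> A"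
  shows "\<bar>f (x(Suc k := a)) - f (x(Suc k := b))\<bar> \<le> c (Suc k)"
proof -
  have "\<bar>f (x(Suc k := a)) - f (x(Suc k := b))\<bar>
      \<le> (\<Sum>j=1..Suc k. c j * of_bool ((x(Suc k := a)) j \<noteq> (x(Suc k := b)) j))"
    using assms by (intro f PiE_Suc_upd)
  also have "(\<Sum>j=1..k. c j * of_bool ((x(Suc k := a)) j \<noteq> (x(Suc k := b)) j)) = 0"
    by (intro sum.neutral) auto
  then have "(\<Sum>j=1..Suc k. c j * of_bool ((x(Suc k := a)) j \<noteq> (x(Suc k := b)) j))
      = c (Suc k) * of_bool (a \<noteq> b)"
    by simp
  also have "\<dots> \<le> c (Suc k)"
    using \<open>c (Suc k) \<ge> 0\<close> by simp
  finally show ?thesis .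
qed

text \<open>The passage from \<open>x\<close> to \<open>y\<close> takes two moves. First the path
  changes while the law \<open>P (x k)\<close> of the last coordinate stays, which costs the
  original constants up to \<open>k\<close>. Then the law changes to \<open>P (y k)\<close>, which
  costs at most \<open>\<alpha> * c (Suc k)\<close> by duality, and nothing if
  \<open>x k = y k\<close>; so this extra cost can be charged to coordinate
  \<open>k\<close>.\<close>

lemma last_step_average_bounded_diff:
  fixes f :: "(nat \<Rightarrow> 'a) \<Rightarrow> real"
  assumes "finite A" "\<And>x. x \<in> A \<Longrightarrow> set_pmf (P x) \<subseteq> A"
    and tv: "\<And>x y. x \<in> A \<Longrightarrow> y \<in> A \<Longrightarrow> tv_dist A (P x) (P y) \<le> \<alpha>"
    and "k \<ge> 1" "c (Suc k) \<ge> 0"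
    and f: "\<And>x y. x \<in> {1..Suc k} \<rightarrow>\<^sub>E A \<Longrightarrow> y \<in> {1..Suc k} \<rightarrow>\<^sub>E A \<Longrightarrow>
              \<bar>f x - f y\<bar> \<le> (\<Sum>j=1..Suc k. c j * of_bool (x j \<noteq> y j))"
    and x: "x \<in> {1..k} \<rightarrow>\<^sub>E A" and y: "y \<in> {1..k} \<rightarrow>\<^sub>E A"
  shows "\<bar>(\<Sum>a\<in>A. pmf (P (x k)) a * f (x(Suc k := a))) - (\<Sum>a\<in>A. pmf (P (y k)) a * f (y(Suc k := a)))\<bar>
       \<le> (\<Sum>j=1..k. (c(k := c k + \<alpha> * c (Suc k))) j * of_bool (x j \<noteq> y j))"
proof -
  define S where "S = (\<Sum>j=1..k. c j * of_bool (x j \<noteq> y j))"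
  have mem: "x k \<in> A" "y k \<in> A"
    using x y \<open>k \<ge> 1\<close> by (auto simp: PiE_iff)
  have diff: "\<bar>f (x(Suc k := a)) - f (y(Suc k := a))\<bar> \<le> S" if "a \<in> A" for a
  proof -
    have "(\<Sum>j=1..Suc k. c j * of_bool ((x(Suc k := a)) j \<noteq> (y(Suc k := a)) j)) = S"
      by (auto simp: S_def intro!: sum.cong)
    then show ?thesis
      using f[OF PiE_Suc_upd[OF x that] PiE_Suc_upd[OF y that]] by simp
  qed
  have osc: "\<bar>f (y(Suc k := a)) - f (y(Suc k := b))\<bar> \<le> c (Suc k)" if "a \<in> A" "b \<in> A" for a b
    using f \<open>c (Suc k) \<ge> 0\<close> y that by (rule bounded_diff_last)
  have "\<bar>(\<Sum>a\<in>A. pmf (P (x k)) a * f (x(Suc k := a))) - (\<Sum>a\<in>A. pmf (P (x k)) a * f (y(Suc k := a)))\<bar>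
      = \<bar>\<Sum>a\<in>A. pmf (P (x k)) a * (f (x(Suc k := a)) - f (y(Suc k := a)))\<bar>"
    by (simp add: sum_subtractf right_diff_distrib)
  also have "\<dots> \<le> (\<Sum>a\<in>A. pmf (P (x k)) a * S)"
    by (intro order.trans[OF sum_abs] sum_mono) (auto simp: abs_mult intro!: mult_left_mono diff)
  also have "\<dots> = S"
    using assms mem by (simp add: sum_distrib_right[symmetric] sum_pmf_eq_1)
  finally have 1: "\<bar>(\<Sum>a\<in>A. pmf (P (x k)) a * f (x(Suc k := a)))
      - (\<Sum>a\<in>A. pmf (P (x k)) a * f (y(Suc k := a)))\<bar> \<le> S" .
  have 2: "\<bar>(\<Sum>a\<in>A. pmf (P (x k)) a * f (y(Suc k := a))) - (\<Sum>a\<in>A. pmf (P (y k)) a * f (y(Suc k := a)))\<bar>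
      \<le> \<alpha> * c (Suc k) * of_bool (x k \<noteq> y k)"
  proof (cases "x k = y k")
    case False
    have "\<bar>(\<Sum>a\<in>A. pmf (P (x k)) a * f (y(Suc k := a))) - (\<Sum>a\<in>A. pmf (P (y k)) a * f (y(Suc k := a)))\<bar>
        \<le> tv_dist A (P (x k)) (P (y k)) * c (Suc k)"
      using assms(1,2) mem osc by (intro sum_pmf_diff_le_tv_dist) auto
    also have "\<dots> \<le> \<alpha> * c (Suc k)"
      using tv mem \<open>c (Suc k) \<ge> 0\<close> by (intro mult_right_mono) auto
    finally show ?thesis
      using False by simp
  qed simp
  have "{1..k} = insert k {1..<k}"
    using \<open>k \<ge> 1\<close> by auto
  moreover have "(\<Sum>j=1..<k. (c(k := c k + \<alpha> * c (Suc k))) j * of_bool (x j \<noteq> y j))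
      = (\<Sum>j=1..<k. c j * of_bool (x j \<noteq> y j))"
    by (intro sum.cong) auto
  ultimately have "(\<Sum>j=1..k. (c(k := c k + \<alpha> * c (Suc k))) j * of_bool (x j \<noteq> y j))
      = S + \<alpha> * c (Suc k) * of_bool (x k \<noteq> y k)"
    by (simp add: S_def algebra_simps)
  then show ?thesis
    using 1 2 by linarith
qed

section \<open>Moment generating function and Chernoff bound\<close>

lemma square_add_mult_le:
  fixes u v \<alpha> :: real
  assumes "0 \<le> \<alpha>" "\<alpha> < 1"
  shows "(u + \<alpha> * v)\<^sup>2 \<le> u\<^sup>2 / (1 - \<alpha>) + \<alpha> * v\<^sup>2"
proof -
  \<comment> \<open>\<open>u + \<alpha> * v\<close> is the average of
    \<open>u / (1 - \<alpha>)\<close> and \<open>v\<close> with weights \<open>1 - \<alpha>\<close>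
    and \<open>\<alpha>\<close>; the convexity gap, cleared of denominators, is an explicit
    square.\<close>
  have "u\<^sup>2 + \<alpha> * v\<^sup>2 * (1 - \<alpha>) - (u + \<alpha> * v)\<^sup>2 * (1 - \<alpha>) = \<alpha> * (u - (1 - \<alpha>) * v)\<^sup>2"
    by (simp add: power2_eq_square algebra_simps)
  also have "\<dots> \<ge> 0"
    using assms by simp
  finally show ?thesis
    using assms by (simp add: field_simps)
qed

text \<open>Induction on \<open>k\<close>, with \<open>f\<close> and \<open>c\<close> generalised
  because summing out a coordinate replaces both. The last coordinate carries only the weight
  \<open>1 / (1 - \<alpha>)\<close>, as it has not yet absorbed any later influence; absorbing the
  next coordinate squares this weight, and the asymmetric bound reproduces itself.\<close>

lemma path_mgf_le:
  fixes f :: "(nat \<Rightarrow> 'a) \<Rightarrow> real"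
  assumes "finite A" "set_pmf p1 \<subseteq> A" "\<And>x. x \<in> A \<Longrightarrow> set_pmf (P x) \<subseteq> A"
    and "\<And>x y. x \<in> A \<Longrightarrow> y \<in> A \<Longrightarrow> tv_dist A (P x) (P y) \<le> \<alpha>"
    and \<alpha>: "0 \<le> \<alpha>" "\<alpha> < 1" and "s > 0"
    and "k \<ge> 1" and "\<And>j. c j \<ge> 0"
    and "\<And>x y. x \<in> {1..k} \<rightarrow>\<^sub>E A \<Longrightarrow> y \<in> {1..k} \<rightarrow>\<^sub>E A \<Longrightarrow>
           \<bar>f x - f y\<bar> \<le> (\<Sum>j=1..k. c j * of_bool (x j \<noteq> y j))"
  shows "(\<Sum>x\<in>{1..k} \<rightarrow>\<^sub>E A. path_weight p1 P k x * exp (s * f x))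
       \<le> exp (s * (\<Sum>x\<in>{1..k} \<rightarrow>\<^sub>E A. path_weight p1 P k x * f x)
              + s\<^sup>2 / 8 * ((\<Sum>j=1..<k. (c j)\<^sup>2) / (1 - \<alpha>)\<^sup>2 + (c k)\<^sup>2 / (1 - \<alpha>)))"
  using assms(8-)
proof (induction k arbitrary: f c rule: nat_induct_at_least)
  case base
  let ?h = "\<lambda>a. f ((\<lambda>_. undefined)(1 := a))"
  \<comment> \<open>This is \<open>bounded_diff_last\<close> with \<open>k = 0\<close>, where the
    function that is \<open>undefined\<close> everywhere is the empty path.\<close>
  have "\<bar>?h a - ?h b\<bar> \<le> c 1" if "a \<in> A" "b \<in> A" for a b
    using bounded_diff_last[of 0 A f c "\<lambda>_. undefined" a b] base that by simp
  then have "(\<Sum>a\<in>A. pmf p1 a * exp (s * ?h a))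
      \<le> exp (s * (\<Sum>a\<in>A. pmf p1 a * ?h a) + s\<^sup>2 * (c 1)\<^sup>2 / 8)"
    using assms by (intro Hoeffding_pmf_finite) auto
  \<comment> \<open>Hoeffding gives the square without a denominator; dividing by
    \<open>1 - \<alpha>\<close> weakens it to the shape of the induction.\<close>
  also have "\<dots> \<le> exp (s * (\<Sum>a\<in>A. pmf p1 a * ?h a) + s\<^sup>2 / 8 * ((c 1)\<^sup>2 / (1 - \<alpha>)))"
  proof -
    have "(c 1)\<^sup>2 \<le> (c 1)\<^sup>2 / (1 - \<alpha>)"
      using \<alpha> by (simp add: le_divide_eq mult_left_le)
    then have "s\<^sup>2 / 8 * (c 1)\<^sup>2 \<le> s\<^sup>2 / 8 * ((c 1)\<^sup>2 / (1 - \<alpha>))"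
      by (intro mult_left_mono) auto
    then show ?thesis
      by simp
  qed
  finally show ?case
    unfolding sum_path_weight_1 by simp
next
  case (Suc k)
  \<comment> \<open>\<open>g\<close> is the conditional expectation of \<open>f\<close> given the
    first \<open>k\<close> coordinates, and \<open>c'\<close> holds its bounded-difference
    constants: the influence of the coordinate summed out passes to its predecessor, damped by
    \<open>\<alpha>\<close>.\<close>
  define g where "g = (\<lambda>x. \<Sum>a\<in>A. pmf (P (x k)) a * f (x(Suc k := a)))"
  define c' where "c' = c(k := c k + \<alpha> * c (Suc k))"
  have step: "(\<Sum>a\<in>A. pmf (P (x k)) a * exp (s * f (x(Suc k := a))))
      \<le> exp (s * g x + s\<^sup>2 * (c (Suc k))\<^sup>2 / 8)" if x: "x \<in> {1..k} \<rightarrow>\<^sub>E A" for x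
    unfolding g_def
  proof (rule Hoeffding_pmf_finite)
    show "set_pmf (P (x k)) \<subseteq> A"
      using x \<open>k \<ge> 1\<close> assms(3) by (auto simp: PiE_iff)
    show "\<bar>f (x(Suc k := a)) - f (x(Suc k := b))\<bar> \<le> c (Suc k)" if "a \<in> A" "b \<in> A" for a b
      using Suc.prems(2,1) x that by (rule bounded_diff_last)
  qed (use assms in auto)
  have "(\<Sum>x\<in>{1..Suc k} \<rightarrow>\<^sub>E A. path_weight p1 P (Suc k) x * exp (s * f x))
      = (\<Sum>x\<in>{1..k} \<rightarrow>\<^sub>E A. path_weight p1 P k x * (\<Sum>a\<in>A. pmf (P (x k)) a * exp (s * f (x(Suc k := a)))))"
    using Suc.hyps by (rule sum_path_weight_Suc)
  also have "\<dots> \<le> (\<Sum>x\<in>{1..k} \<rightarrow>\<^sub>E A. path_weight p1 P k x * exp (s * g x + s\<^sup>2 * (c (Suc k))\<^sup>2 / 8))"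
    by (intro sum_mono mult_left_mono step path_weight_nonneg)
  \<comment> \<open>The Hoeffding factor is the same for all paths, so it leaves the sum and the
    induction hypothesis applies to \<open>g\<close>.\<close>
  also have "\<dots> = (\<Sum>x\<in>{1..k} \<rightarrow>\<^sub>E A. path_weight p1 P k x * exp (s * g x)) * exp (s\<^sup>2 * (c (Suc k))\<^sup>2 / 8)"
    by (simp add: exp_add sum_distrib_right mult.assoc)
  also have "\<dots> \<le> exp (s * (\<Sum>x\<in>{1..k} \<rightarrow>\<^sub>E A. path_weight p1 P k x * g x)
      + s\<^sup>2 / 8 * ((\<Sum>j=1..<k. (c' j)\<^sup>2) / (1 - \<alpha>)\<^sup>2 + (c' k)\<^sup>2 / (1 - \<alpha>))) * exp (s\<^sup>2 * (c (Suc k))\<^sup>2 / 8)"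
  proof (intro mult_right_mono Suc.IH)
    show "c' j \<ge> 0" for j
      using Suc.prems(1) \<alpha> by (simp add: c'_def)
    show "\<bar>g x - g y\<bar> \<le> (\<Sum>j=1..k. c' j * of_bool (x j \<noteq> y j))"
      if "x \<in> {1..k} \<rightarrow>\<^sub>E A" "y \<in> {1..k} \<rightarrow>\<^sub>E A" for x y
      unfolding g_def c'_def using assms(1,3,4) Suc.hyps Suc.prems that
      by (intro last_step_average_bounded_diff) auto
  qed auto
  \<comment> \<open>Conditioning preserves the mean, so the linear term of the exponent is again
    governed by the mean of \<open>f\<close>.\<close>
  also have "(\<Sum>x\<in>{1..k} \<rightarrow>\<^sub>E A. path_weight p1 P k x * g x)
      = (\<Sum>x\<in>{1..Suc k} \<rightarrow>\<^sub>E A. path_weight p1 P (Suc k) x * f x)"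
    unfolding g_def using Suc.hyps by (rule sum_path_weight_Suc[symmetric])
  also have "exp (s * \<dots> + s\<^sup>2 / 8 * ((\<Sum>j=1..<k. (c' j)\<^sup>2) / (1 - \<alpha>)\<^sup>2 + (c' k)\<^sup>2 / (1 - \<alpha>)))
        * exp (s\<^sup>2 * (c (Suc k))\<^sup>2 / 8)
      = exp (s * (\<Sum>x\<in>{1..Suc k} \<rightarrow>\<^sub>E A. path_weight p1 P (Suc k) x * f x) + s\<^sup>2 / 8 *
          ((\<Sum>j=1..<k. (c' j)\<^sup>2) / (1 - \<alpha>)\<^sup>2 + (c' k)\<^sup>2 / (1 - \<alpha>) + (c (Suc k))\<^sup>2))"
    by (simp add: exp_add[symmetric] algebra_simps)
  also have "\<dots> \<le> exp (s * (\<Sum>x\<in>{1..Suc k} \<rightarrow>\<^sub>E A. path_weight p1 P (Suc k) x * f x) + s\<^sup>2 / 8 *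
          ((\<Sum>j=1..<Suc k. (c j)\<^sup>2) / (1 - \<alpha>)\<^sup>2 + (c (Suc k))\<^sup>2 / (1 - \<alpha>)))"
  proof -
    have "(\<Sum>j=1..<k. (c' j)\<^sup>2) = (\<Sum>j=1..<k. (c j)\<^sup>2)"
      by (intro sum.cong) (auto simp: c'_def)
    \<comment> \<open>Dividing the convexity bound by \<open>1 - \<alpha>\<close> gives
      \<open>(c (Suc k))\<^sup>2\<close> the coefficient \<open>\<alpha> / (1 - \<alpha>)\<close>;
      the 1 from the current Hoeffding factor completes it to
      \<open>1 / (1 - \<alpha>)\<close>.\<close>
    moreover have "(c' k)\<^sup>2 / (1 - \<alpha>) + (c (Suc k))\<^sup>2 \<le> (c k)\<^sup>2 / (1 - \<alpha>)\<^sup>2 + (c (Suc k))\<^sup>2 / (1 - \<alpha>)"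
    proof -
      have "(c' k)\<^sup>2 / (1 - \<alpha>) \<le> ((c k)\<^sup>2 / (1 - \<alpha>) + \<alpha> * (c (Suc k))\<^sup>2) / (1 - \<alpha>)"
        unfolding c'_def using \<alpha> square_add_mult_le[OF \<alpha>, of "c k" "c (Suc k)"]
        by (intro divide_right_mono) auto
      also have "\<dots> = (c k)\<^sup>2 / (1 - \<alpha>)\<^sup>2 + \<alpha> * (c (Suc k))\<^sup>2 / (1 - \<alpha>)"
        by (simp add: add_divide_distrib power2_eq_square)
      also have "\<alpha> * (c (Suc k))\<^sup>2 / (1 - \<alpha>) = (c (Suc k))\<^sup>2 / (1 - \<alpha>) - (c (Suc k))\<^sup>2"
        using \<alpha> by (simp add: field_simps)
      finally show ?thesis
        by simp
    qed
    ultimately have "(\<Sum>j=1..<k. (c' j)\<^sup>2) / (1 - \<alpha>)\<^sup>2 + (c' k)\<^sup>2 / (1 - \<alpha>) + (c (Suc k))\<^sup>2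
        \<le> (\<Sum>j=1..<Suc k. (c j)\<^sup>2) / (1 - \<alpha>)\<^sup>2 + (c (Suc k))\<^sup>2 / (1 - \<alpha>)"
      using Suc.hyps by (simp add: add_divide_distrib)
    then show ?thesis
      by (intro iffD2[OF exp_le_cancel_iff] add_left_mono mult_left_mono) auto
  qed
  finally show ?case .
qed

text \<open>Chernoff's method: bound the indicator by an exponential, insert the bound on the moment
  generating function and optimise over \<open>s\<close>. Positivity of the sum of squares lets the
  optimal \<open>s\<close> be formed by division.\<close>

lemma path_upper_tail_le:
  fixes f :: "(nat \<Rightarrow> 'a) \<Rightarrow> real"
  assumes "finite A" "set_pmf p1 \<subseteq> A" "\<And>x. x \<in> A \<Longrightarrow> set_pmf (P x) \<subseteq> A"
    and "\<And>x y. x \<in> A \<Longrightarrow> y \<in> A \<Longrightarrow> tv_dist A (P x) (P y) \<le> \<alpha>"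
    and \<alpha>: "0 \<le> \<alpha>" "\<alpha> < 1" and "t > 0"
    and "N \<ge> 1" and "\<And>j. c j \<ge> 0" and pos: "(\<Sum>j=1..N. (c j)\<^sup>2) > 0"
    and "\<And>x y. x \<in> {1..N} \<rightarrow>\<^sub>E A \<Longrightarrow> y \<in> {1..N} \<rightarrow>\<^sub>E A \<Longrightarrow>
           \<bar>f x - f y\<bar> \<le> (\<Sum>j=1..N. c j * of_bool (x j \<noteq> y j))"
  defines "m \<equiv> (\<Sum>x\<in>{1..N} \<rightarrow>\<^sub>E A. path_weight p1 P N x * f x)"
  shows "(\<Sum>x\<in>{1..N} \<rightarrow>\<^sub>E A. path_weight p1 P N x * of_bool (f x - m \<ge> t))
       \<le> exp (- (2 * t\<^sup>2 * (1 - \<alpha>)\<^sup>2 / (\<Sum>j=1..N. (c j)\<^sup>2)))"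
proof -
  define V where "V = (\<Sum>j=1..N. (c j)\<^sup>2) / (1 - \<alpha>)\<^sup>2"
  have "V > 0"
    unfolding V_def using pos \<alpha> by (intro divide_pos_pos) auto
  \<comment> \<open>The exponent will be \<open>s\<^sup>2 / 8 * V - s * t\<close>; this
    \<open>s\<close> is its minimiser, with minimum \<open>- (2 * t\<^sup>2 / V)\<close>.\<close>
  define s where "s = 4 * t / V"
  have "s > 0"
    using \<open>V > 0\<close> \<open>t > 0\<close> by (simp add: s_def)
  \<comment> \<open>Since \<open>(1 - \<alpha>)\<^sup>2 \<le> 1 - \<alpha>\<close>, the last
    coordinate can be given the same weight as the others, which produces the Euclidean
    norm.\<close>
  have V: "(\<Sum>j=1..<N. (c j)\<^sup>2) / (1 - \<alpha>)\<^sup>2 + (c N)\<^sup>2 / (1 - \<alpha>) \<le> V"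
  proof -
    have "(1 - \<alpha>)\<^sup>2 \<le> 1 - \<alpha>"
      using \<alpha> by (simp add: power2_eq_square mult_left_le)
    then have "(c N)\<^sup>2 / (1 - \<alpha>) \<le> (c N)\<^sup>2 / (1 - \<alpha>)\<^sup>2"
      using \<alpha> by (intro divide_left_mono) auto
    moreover have "{1..N} = insert N {1..<N}"
      using \<open>N \<ge> 1\<close> by auto
    ultimately show ?thesis
      by (simp add: V_def add_divide_distrib)
  qed
  have "(\<Sum>x\<in>{1..N} \<rightarrow>\<^sub>E A. path_weight p1 P N x * of_bool (f x - m \<ge> t))
      \<le> (\<Sum>x\<in>{1..N} \<rightarrow>\<^sub>E A. path_weight p1 P N x * (exp (s * f x) * exp (- s * (m + t))))"
  proof (intro sum_mono mult_left_mono path_weight_nonneg)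
    fix x
    have "s * f x - s * (m + t) \<ge> 0" if "f x - m \<ge> t"
      using that \<open>s > 0\<close> by (simp add: right_diff_distrib[symmetric])
    then show "of_bool (f x - m \<ge> t) \<le> exp (s * f x) * exp (- s * (m + t))"
      by (simp add: exp_add[symmetric])
  qed
  also have "\<dots> = (\<Sum>x\<in>{1..N} \<rightarrow>\<^sub>E A. path_weight p1 P N x * exp (s * f x)) * exp (- s * (m + t))"
    by (simp add: sum_distrib_right mult.assoc)
  also have "\<dots> \<le> exp (s * m + s\<^sup>2 / 8 * ((\<Sum>j=1..<N. (c j)\<^sup>2) / (1 - \<alpha>)\<^sup>2 + (c N)\<^sup>2 / (1 - \<alpha>)))
      * exp (- s * (m + t))"
    unfolding m_def using assms \<open>s > 0\<close> by (intro mult_right_mono path_mgf_le) auto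
  also have "\<dots> \<le> exp (s * m + s\<^sup>2 / 8 * V) * exp (- s * (m + t))"
    using V by (intro mult_right_mono iffD2[OF exp_le_cancel_iff] add_left_mono mult_left_mono) auto
  also have "\<dots> = exp (s\<^sup>2 / 8 * V - s * t)"
    by (simp add: exp_add[symmetric] algebra_simps)
  also have "s\<^sup>2 / 8 * V - s * t = - (2 * t\<^sup>2 / V)"
    using \<open>V > 0\<close> by (simp add: s_def field_simps power2_eq_square)
  also have "2 * t\<^sup>2 / V = 2 * t\<^sup>2 * (1 - \<alpha>)\<^sup>2 / (\<Sum>j=1..N. (c j)\<^sup>2)"
    by (simp add: V_def)
  finally show ?thesis .
qed

section \<open>From the probability space to finite sums over paths\<close>

lemma chain_path_in_PiE:
  assumes "homogeneous_markov_chain M A N p1 P X" "\<omega> \<in> space M"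
  shows "chain_path N X \<omega> \<in> {1..N} \<rightarrow>\<^sub>E A"
  using assms by (auto simp: homogeneous_markov_chain_def chain_path_def dest!: measurable_space)

text \<open>The events \<open>B x\<close> that the path equals \<open>x\<close> split the space into
  finitely many measurable pieces, whose measures the chain hypothesis prescribes. A function of the
  path is therefore simple, and an event about the path is a finite union.\<close>

lemma
  fixes g :: "(nat \<Rightarrow> 'a) \<Rightarrow> real"
  assumes "finite A" and chain: "homogeneous_markov_chain M A N p1 P X"
  shows integral_chain_path: "integral\<^sup>L M (\<lambda>\<omega>. g (chain_path N X \<omega>))
          = (\<Sum>x\<in>{1..N} \<rightarrow>\<^sub>E A. path_weight p1 P N x * g x)"
    and sets_chain_path: "{\<omega>\<in>space M. Q (chain_path N X \<omega>)} \<in> sets M"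
proof -
  interpret prob_space M
    using chain by (simp add: homogeneous_markov_chain_def)
  define B where "B = (\<lambda>x. {\<omega>\<in>space M. \<forall>j\<in>{1..N}. X j \<omega> = x j})"
  have X: "X j \<in> measurable M (count_space A)" if "j \<in> {1..N}" for j
    using chain that by (auto simp: homogeneous_markov_chain_def)
  have B_sets: "B x \<in> sets M" if "x \<in> {1..N} \<rightarrow>\<^sub>E A" for x
    unfolding B_def
  proof (rule sets.sets_Collect_finite_All)
    fix j assume "j \<in> {1..N}"
    then have "X j -` {x j} \<inter> space M \<in> sets M"
      using that by (intro measurable_sets[OF X]) (auto simp: PiE_iff)
    then show "{\<omega>\<in>space M. X j \<omega> = x j} \<in> sets M"
      by (simp add: vimage_def Int_def conj_commute)
  qed auto
  have fin: "finite ({1..N} \<rightarrow>\<^sub>E A)"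
    using assms by (intro finite_PiE) auto
  have B_iff: "\<omega> \<in> B x \<longleftrightarrow> chain_path N X \<omega> = x" if "x \<in> {1..N} \<rightarrow>\<^sub>E A" "\<omega> \<in> space M" for x \<omega>
    using that by (auto simp: B_def chain_path_def PiE_iff extensional_def restrict_def fun_eq_iff)
  have "{\<omega>\<in>space M. Q (chain_path N X \<omega>)} = (\<Union>x\<in>{x\<in>{1..N} \<rightarrow>\<^sub>E A. Q x}. B x)"
    using chain_path_in_PiE[OF chain] B_iff by (auto simp: B_def)
  then show "{\<omega>\<in>space M. Q (chain_path N X \<omega>)} \<in> sets M"
    using fin B_sets by (auto intro!: sets.finite_UN)
  \<comment> \<open>Only the indicator belonging to the path actually taken survives.\<close>
  have "g (chain_path N X \<omega>) = (\<Sum>x\<in>{1..N} \<rightarrow>\<^sub>E A. indicator (B x) \<omega> * g x)" if "\<omega> \<in> space M" for \<omega>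
  proof -
    have "(\<Sum>x\<in>{1..N} \<rightarrow>\<^sub>E A. indicator (B x) \<omega> * g x)
        = (\<Sum>x\<in>{1..N} \<rightarrow>\<^sub>E A. if chain_path N X \<omega> = x then g x else 0)"
      using B_iff[OF _ that] by (intro sum.cong) (auto simp: indicator_def)
    then show ?thesis
      using fin chain_path_in_PiE[OF chain that] by simp
  qed
  then have "integral\<^sup>L M (\<lambda>\<omega>. g (chain_path N X \<omega>))
      = integral\<^sup>L M (\<lambda>\<omega>. \<Sum>x\<in>{1..N} \<rightarrow>\<^sub>E A. indicator (B x) \<omega> * g x)"
    by (intro Bochner_Integration.integral_cong) auto
  also have "\<dots> = (\<Sum>x\<in>{1..N} \<rightarrow>\<^sub>E A. integral\<^sup>L M (\<lambda>\<omega>. indicator (B x) \<omega> * g x))"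
    using B_sets by (intro Bochner_Integration.integral_sum) (auto simp: emeasure_eq_measure)
  also have "\<dots> = (\<Sum>x\<in>{1..N} \<rightarrow>\<^sub>E A. path_weight p1 P N x * g x)"
  proof (intro sum.cong refl)
    fix x assume x: "x \<in> {1..N} \<rightarrow>\<^sub>E A"
    then have "measure M (B x) = path_weight p1 P N x"
      using chain by (auto simp: homogeneous_markov_chain_def B_def path_weight_def)
    then show "integral\<^sup>L M (\<lambda>\<omega>. indicator (B x) \<omega> * g x) = path_weight p1 P N x * g x"
      using B_sets[OF x] by (simp add: emeasure_eq_measure)
  qed
  finally show "integral\<^sup>L M (\<lambda>\<omega>. g (chain_path N X \<omega>))
          = (\<Sum>x\<in>{1..N} \<rightarrow>\<^sub>E A. path_weight p1 P N x * g x)" .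
qed

lemma measure_chain_path:
  assumes "finite A" and chain: "homogeneous_markov_chain M A N p1 P X"
  shows "measure M {\<omega>\<in>space M. Q (chain_path N X \<omega>)}
       = (\<Sum>x\<in>{1..N} \<rightarrow>\<^sub>E A. path_weight p1 P N x * of_bool (Q x))"
proof -
  interpret prob_space M
    using chain by (simp add: homogeneous_markov_chain_def)
  let ?S = "{\<omega>\<in>space M. Q (chain_path N X \<omega>)}"
  have "measure M ?S = integral\<^sup>L M (indicator ?S)"
    using sets_chain_path[OF assms, of Q] by (simp add: emeasure_eq_measure)
  also have "\<dots> = integral\<^sup>L M (\<lambda>\<omega>. of_bool (Q (chain_path N X \<omega>)))"
    by (intro Bochner_Integration.integral_cong) (auto simp: indicator_def)
  finally show ?thesis
    using integral_chain_path[OF assms, of "\<lambda>x. of_bool (Q x)"] by simp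
qed

section \<open>The Dobrushin coefficient and the two-sided bound\<close>

lemma tv_dist_le_dobrushin_coeff:
  assumes "finite A" "x \<in> A" "y \<in> A"
  shows "tv_dist A (P x) (P y) \<le> dobrushin_coeff A P"
proof -
  have "{tv_dist A (P x) (P x') | x x'. x \<in> A \<and> x' \<in> A} = (\<lambda>(x, x'). tv_dist A (P x) (P x')) ` (A \<times> A)"
    by auto
  then show ?thesis
    unfolding dobrushin_coeff_def using assms by (auto intro!: Max_ge)
qed

theorem proposition4p1:
  fixes M :: "'w measure" and A :: "'a set" and N :: nat
    and p1 :: "'a pmf" and P :: "'a \<Rightarrow> 'a pmf" and X :: "nat \<Rightarrow> 'w \<Rightarrow> 'a"
    and f :: "(nat \<Rightarrow> 'a) \<Rightarrow> real" and c :: "nat \<Rightarrow> real" and \<alpha> t :: real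
  assumes "N \<ge> 1"
    and "finite A"
    and "homogeneous_markov_chain M A N p1 P X"
    and "\<alpha> = dobrushin_coeff A P"
    and "0 < \<alpha>" and "\<alpha> < 1"
    and "\<forall>x\<in>{1..N} \<rightarrow>\<^sub>E A. \<forall>y\<in>{1..N} \<rightarrow>\<^sub>E A.
           \<bar>f x - f y\<bar> \<le> (\<Sum>j=1..N. c j * of_bool (x j \<noteq> y j))"
    and "t > 0"
  shows "measure M {\<omega>\<in>space M.
             \<bar>f (chain_path N X \<omega>) - integral\<^sup>L M (\<lambda>\<omega>'. f (chain_path N X \<omega>'))\<bar> \<ge> t}
         \<le> (if \<forall>j\<in>{1..N}. c j = 0 then 0
             else 2 * exp (- (2 * t\<^sup>2 * (1 - \<alpha>)\<^sup>2 / (\<Sum>j=1..N. (c j)\<^sup>2))))"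
proof (cases "\<forall>j\<in>{1..N}. c j = 0")
  case True
  interpret prob_space M
    using assms(3) by (simp add: homogeneous_markov_chain_def)
  \<comment> \<open>With all constants zero, \<open>f\<close> has the same value on all realised
    paths. It then equals its mean everywhere, and the deviation event is empty because
    \<open>t > 0\<close>.\<close>
  have eq: "f (chain_path N X \<omega>) = f (chain_path N X \<omega>')" if "\<omega> \<in> space M" "\<omega>' \<in> space M" for \<omega> \<omega>'
  proof -
    have "\<bar>f (chain_path N X \<omega>) - f (chain_path N X \<omega>')\<bar>
        \<le> (\<Sum>j=1..N. c j * of_bool (chain_path N X \<omega> j \<noteq> chain_path N X \<omega>' j))"
      using assms(7) chain_path_in_PiE[OF assms(3)] that by blast
    also have "\<dots> = 0"
      using True by (intro sum.neutral) auto
    finally show ?thesis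
      by simp
  qed
  have "integral\<^sup>L M (\<lambda>\<omega>'. f (chain_path N X \<omega>')) = f (chain_path N X \<omega>)" if "\<omega> \<in> space M" for \<omega>
  proof -
    have "integral\<^sup>L M (\<lambda>\<omega>'. f (chain_path N X \<omega>')) = integral\<^sup>L M (\<lambda>_. f (chain_path N X \<omega>))"
      using that by (intro Bochner_Integration.integral_cong refl eq)
    then show ?thesis
      by (simp add: prob_space)
  qed
  then have "{\<omega>\<in>space M. \<bar>f (chain_path N X \<omega>) - integral\<^sup>L M (\<lambda>\<omega>'. f (chain_path N X \<omega>'))\<bar> \<ge> t} = {}"
    using \<open>t > 0\<close> by auto
  then show ?thesis
    by (simp only: measure_empty if_P[OF True])
next
  case False
  define m where "m = (\<Sum>x\<in>{1..N} \<rightarrow>\<^sub>E A. path_weight p1 P N x * f x)"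
  define R where "R = exp (- (2 * t\<^sup>2 * (1 - \<alpha>)\<^sup>2 / (\<Sum>j=1..N. (c j)\<^sup>2)))"
  have supp: "set_pmf p1 \<subseteq> A" "\<And>x. x \<in> A \<Longrightarrow> set_pmf (P x) \<subseteq> A"
    using assms(3) by (auto simp: homogeneous_markov_chain_def)
  have tv: "tv_dist A (P x) (P y) \<le> \<alpha>" if "x \<in> A" "y \<in> A" for x y
    using tv_dist_le_dobrushin_coeff[OF assms(2) that] assms(4) by simp
  obtain i where "i \<in> {1..N}" "c i \<noteq> 0"
    using False by auto
  then have pos: "(\<Sum>j=1..N. \<bar>c j\<bar>\<^sup>2) > 0"
    by (intro sum_pos2[where i = i]) auto
  \<comment> \<open>\<open>path_upper_tail_le\<close> asks for nonnegative constants at every index,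
    also outside \<open>{1..N}\<close>. Absolute values provide this; they can only enlarge the
    bound and leave the squares unchanged.\<close>
  have f: "\<bar>f x - f y\<bar> \<le> (\<Sum>j=1..N. \<bar>c j\<bar> * of_bool (x j \<noteq> y j))"
    if "x \<in> {1..N} \<rightarrow>\<^sub>E A" "y \<in> {1..N} \<rightarrow>\<^sub>E A" for x y
  proof -
    have "\<bar>f x - f y\<bar> \<le> (\<Sum>j=1..N. c j * of_bool (x j \<noteq> y j))"
      using assms(7) that by blast
    also have "\<dots> \<le> (\<Sum>j=1..N. \<bar>c j\<bar> * of_bool (x j \<noteq> y j))"
      by (intro sum_mono mult_right_mono) auto
    finally show ?thesis .
  qed
  have upper: "(\<Sum>x\<in>{1..N} \<rightarrow>\<^sub>E A. path_weight p1 P N x * of_bool (f x - m \<ge> t)) \<le> R"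
    using path_upper_tail_le[where f = f and c = "\<lambda>j. \<bar>c j\<bar>",
        OF assms(2) supp tv less_imp_le[OF assms(5)] assms(6,8,1) abs_ge_zero pos f]
    by (simp add: m_def R_def)
  have f': "\<bar>- f x - - f y\<bar> \<le> (\<Sum>j=1..N. \<bar>c j\<bar> * of_bool (x j \<noteq> y j))"
    if "x \<in> {1..N} \<rightarrow>\<^sub>E A" "y \<in> {1..N} \<rightarrow>\<^sub>E A" for x y
    using f[OF that] by (simp add: abs_minus_commute)
  \<comment> \<open>The lower tail of \<open>f\<close> is the upper tail of \<open>- f\<close>,
    which has mean \<open>- m\<close> and the same constants.\<close>
  have lower: "(\<Sum>x\<in>{1..N} \<rightarrow>\<^sub>E A. path_weight p1 P N x * of_bool (- f x + m \<ge> t)) \<le> R"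
    using path_upper_tail_le[where f = "\<lambda>x. - f x" and c = "\<lambda>j. \<bar>c j\<bar>",
        OF assms(2) supp tv less_imp_le[OF assms(5)] assms(6,8,1) abs_ge_zero pos f']
    by (simp add: m_def R_def sum_negf)
  have "measure M {\<omega>\<in>space M. \<bar>f (chain_path N X \<omega>) - integral\<^sup>L M (\<lambda>\<omega>'. f (chain_path N X \<omega>'))\<bar> \<ge> t}
      = (\<Sum>x\<in>{1..N} \<rightarrow>\<^sub>E A. path_weight p1 P N x * of_bool (\<bar>f x - m\<bar> \<ge> t))"
    unfolding integral_chain_path[OF assms(2,3)] m_def[symmetric]
    by (rule measure_chain_path[OF assms(2,3)])
  \<comment> \<open>Union bound: a deviation of at least \<open>t\<close> lies above or below the
    mean, whence the factor 2.\<close>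
  also have "\<dots> \<le> (\<Sum>x\<in>{1..N} \<rightarrow>\<^sub>E A. path_weight p1 P N x * (of_bool (f x - m \<ge> t) + of_bool (- f x + m \<ge> t)))"
    by (intro sum_mono mult_left_mono path_weight_nonneg) auto
  also have "\<dots> \<le> 2 * R"
    using upper lower by (simp add: distrib_left sum.distrib)
  finally show ?thesis
    using False by (auto simp: R_def)
qed

end
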